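(* Let $n$ be a positive integer. Let $\mathcal{I}_n\subseteq \mathfrak{S}_n$ be the set of interleaved permutations and let $\mathcal{C}_n\subseteq\mathfrak{S}_n$ be the set of right canonical permutations. Then $\mathcal{C}_n=\mathcal{I}_n$. Consequently, the set $\mathcal{A}_n=\{S \mid S=\operatorname{Pin}\pi \text{ for some } \pi\in\mathfrak{S}_n\}$ satisfies $$\#\mathcal{A}_n=\binom{n-1}{\left\lfloor\frac{n-1}{2}\right\rfloor}.$$
   Context: Notation: $[n]=\{1,\dots,n\}$, $[m,n]=\{m,m+1,\dots,n\}$, $\#$ denotes cardinality. $\mathfrak{S}_n$ is the set of permutations $\pi=\pi_1\pi_2\ldots\pi_n$ of $[n]$ in one-line notation. The pinnacle set of $\pi\in\mathfrak{S}_n$ is $\operatorname{Pin}\pi=\{\pi_i \mid 2\le i\le n-1,\ \pi_{i-1}<\pi_i>\pi_{i+1}\}$. A set $S$ is an admissible pinnacle set if $S=\operatorname{Pin}\pi$ for some permutation $\pi$ (of some $[n']$). Interleaved permutations: for $A\subseteq[2,n]$ with $\#A=\lfloor (n-1)/2\rfloor$, the interleaved permutation $\pi\in\mathfrak{S}_n$ corresponding to $A$ is obtained by (I1) filling the first $\lfloor (n-1)/2\rfloor$ even positions of $\pi$ (positions $2,4,\dots,2\lfloor (n-1)/2\rfloor$) with the elements of $A$ in increasing order from left to right, and (I2) filling the remaining positions with the elements of $[n]-A$ in increasing order from left to right. $\mathcal{I}_n$ is the set of all permutations obtained this way. Right canonical permutations: let $S\subseteq[n]$ be an admissible pinnacle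 set and $\overline{S}=[n]-S$. If $n$ is odd, the right canonical permutation $\pi$ of $S$ is built by filling positions from right to left (starting with position $n$) as follows. (C1) Place elements of $\overline{S}$ moving right to left, starting with the largest unused element of $\overline{S}$ and then decreasing, until an element less than the largest unused element of $S$ has been placed (if no element of $S$ is unused, place all the remaining elements of $\overline{S}$). (C2) Place the largest unused element of $S$ in the rightmost unused position. (C3) Iterate C1 and C2 until all elements of $S$ and $\overline{S}$ are placed. If $n$ is even, the only change is that both $\pi_n$ and $\pi_{n-1}$ are filled with elements of $\overline{S}$ (the largest, then the second largest) before considering whether to place an element of $S$. $\mathcal{C}_n$ is the set of right canonical permutations of all admissible $S\subseteq[n]$. *)

theory Defs
  imports "HOL-Combinatorics.Multiset_Permutations"
begin

text \<open>
  A permutation of \<open>{1..n}\<close> is a list in one-line notation, an element of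
  \<open>permutations_of_set {1..n}\<close>. Positions are counted from 1 as in the mathematics,
  so the entry of \<open>\<pi>\<close> at position \<open>i\<close> is \<open>\<pi> ! (i - 1)\<close>.
\<close>

abbreviation perms :: "nat \<Rightarrow> nat list set" where
  "perms n \<equiv> permutations_of_set {1..n}"

definition Pin :: "nat list \<Rightarrow> nat set" where
  "Pin \<pi> = {\<pi> ! (i - 1) | i. 2 \<le> i \<and> i \<le> length \<pi> - 1 \<and>
              \<pi> ! (i - 2) < \<pi> ! (i - 1) \<and> \<pi> ! (i - 1) > \<pi> ! i}"

definition admissible :: "nat set \<Rightarrow> bool" where
  "admissible S \<longleftrightarrow> (\<exists>n' \<pi>. \<pi> \<in> perms n' \<and> S = Pin \<pi>)"

definition pinnacle_sets :: "nat \<Rightarrow> nat set set" where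
  "pinnacle_sets n = {S. \<exists>\<pi> \<in> perms n. S = Pin \<pi>}"

text \<open>
  \<open>fill P V i\<close> is the value at position \<open>i \<in> P\<close> when the positions in \<open>P\<close> are
  filled from left to right with the elements of \<open>V\<close> in increasing order.
\<close>

definition fill :: "nat set \<Rightarrow> nat set \<Rightarrow> nat \<Rightarrow> nat" where
  "fill P V i = sorted_list_of_set V ! card {j \<in> P. j < i}"

definition even_positions :: "nat \<Rightarrow> nat set" where
  "even_positions n = {2 * k | k. 1 \<le> k \<and> k \<le> (n - 1) div 2}"

definition interleaved :: "nat \<Rightarrow> nat set \<Rightarrow> nat list" where
  "interleaved n A =
     map (\<lambda>i. if i \<in> even_positions n then fill (even_positions n) A i
               else fill ({1..n} - even_positions n) ({1..n} - A) i) [1..<n + 1]"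

definition interleaved_perms :: "nat \<Rightarrow> nat list set" where
  "interleaved_perms n = {interleaved n A | A. A \<subseteq> {2..n} \<and> card A = (n - 1) div 2}"

text \<open>
  Right-to-left filling. In \<open>place ss us \<pi>\<close>, the lists \<open>ss\<close> and \<open>us\<close> hold the unused
  elements of \<open>S\<close> and of its complement, largest first, and \<open>\<pi>\<close> is the part already
  filled, which occupies the rightmost positions. The next element placed is the largest
  unused \<open>u\<close> outside \<open>S\<close>. If it is less than the largest unused \<open>s\<close> in \<open>S\<close>, then \<open>s\<close>
  is placed next; otherwise further elements outside \<open>S\<close> follow. At least one element
  outside \<open>S\<close> is placed between two pinnacles, even if the element just before the last
  pinnacle is already less than the new \<open>s\<close>.
  The second equation only makes the function total: for an admissible \<open>S\<close>, the complement
  is never exhausted before \<open>S\<close>.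
\<close>

fun place :: "nat list \<Rightarrow> nat list \<Rightarrow> nat list \<Rightarrow> nat list" where
  "place [] us \<pi> = rev us @ \<pi>"
| "place (s # ss) [] \<pi> = rev (s # ss) @ \<pi>"
| "place (s # ss) (u # us) \<pi> =
     (if u < s then place ss us (s # u # \<pi>) else place (s # ss) us (u # \<pi>))"

text \<open>
  For even \<open>n\<close> the largest element outside \<open>S\<close> is placed without any comparison. As
  \<open>place\<close> compares only after placing a further element, positions \<open>n\<close> and \<open>n - 1\<close> are
  then both filled before an element of \<open>S\<close> is considered.
\<close>

definition right_canonical :: "nat \<Rightarrow> nat set \<Rightarrow> nat list" where
  "right_canonical n S =
     (let ss = rev (sorted_list_of_set S);
          us = rev (sorted_list_of_set ({1..n} - S))
      in if odd n then place ss us [] else place ss (drop 1 us) (take 1 us))"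

definition right_canonical_perms :: "nat \<Rightarrow> nat list set" where
  "right_canonical_perms n = {right_canonical n S | S. S \<subseteq> {1..n} \<and> admissible S}"

lemma fill_image:
  assumes "finite P" "finite V" "card P = card V"
  shows "fill P V ` P = V"
proof -
  let ?r = "\<lambda>i. card {j \<in> P. j < i}"
  have lt: "?r i < ?r k" if "i \<in> P" "k \<in> P" "i < k" for i k
    using that assms(1) by (intro psubset_card_mono) auto
  have "inj_on ?r P"
    by (rule linorder_inj_onI) (use lt in force)+
  moreover have "?r ` P \<subseteq> {..<card P}"
    using assms(1) by (auto intro!: psubset_card_mono)
  ultimately have "?r ` P = {..<card P}"
    by (intro card_subset_eq) (auto simp: card_image)
  moreover have "fill P V ` P = (!) (sorted_list_of_set V) ` ?r ` P"
    by (auto simp: fill_def image_image)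
  moreover have "(!) (sorted_list_of_set V) ` {..<card V} = V"
    using assms(2) nth_image[of "card V" "sorted_list_of_set V"]
    by (simp add: atLeast0LessThan)
  ultimately show ?thesis using assms(3) by simp
qed

lemma interleaved_perms_subset: "interleaved_perms n \<subseteq> perms n"
proof
  fix \<pi> assume "\<pi> \<in> interleaved_perms n"
  then obtain A where A: "A \<subseteq> {2..n}" "card A = (n - 1) div 2" and \<pi>: "\<pi> = interleaved n A"
    by (auto simp: interleaved_perms_def)
  let ?E = "even_positions n"
  have E: "?E = (\<lambda>k. 2 * k) ` {1..(n - 1) div 2}"
    by (auto simp: even_positions_def)
  have cE: "card ?E = card A"
    by (simp add: E A(2) card_image inj_on_def)
  have sE: "?E \<subseteq> {1..n}" and fE: "finite ?E" by (auto simp: E)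
  have sA: "A \<subseteq> {1..n}" and fA: "finite A" using A(1) finite_subset by fastforce+
  have "set \<pi> = fill ?E A ` ?E \<union> fill ({1..n} - ?E) ({1..n} - A) ` ({1..n} - ?E)"
  proof -
    have "set \<pi> = (\<lambda>i. if i \<in> ?E then fill ?E A i
                      else fill ({1..n} - ?E) ({1..n} - A) i) ` {1..n}"
      by (simp add: \<pi> interleaved_def atLeastLessThanSuc_atLeastAtMost del: upt_Suc)
    moreover have "{1..n} \<inter> {i. i \<in> ?E} = ?E" "{1..n} \<inter> {i. i \<notin> ?E} = {1..n} - ?E"
      using sE by auto
    ultimately show ?thesis by (simp only: if_image_distrib)
  qed
  also have "\<dots> = A \<union> ({1..n} - A)"
    using sA fA sE fE cE by (simp add: fill_image card_Diff_subset)
  finally have s: "set \<pi> = {1..n}" using sA by blast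
  moreover have "length \<pi> = n" by (simp add: \<pi> interleaved_def)
  ultimately have "distinct \<pi>" by (intro card_distinct) simp
  with s show "\<pi> \<in> perms n" by (simp add: permutations_of_set_def)
qed

lemma mset_place: "mset (place ss us \<pi>) = mset ss + mset us + mset \<pi>"
  by (induction ss us \<pi> rule: place.induct) auto

lemma right_canonical_perms_subset: "right_canonical_perms n \<subseteq> perms n"
proof
  fix \<pi> assume "\<pi> \<in> right_canonical_perms n"
  then obtain S where S: "S \<subseteq> {1..n}" and \<pi>: "\<pi> = right_canonical n S"
    by (auto simp: right_canonical_perms_def)
  have fin: "finite S" using S finite_subset by blast
  have td: "mset (drop 1 us) + mset (take 1 us) = mset us" for us :: "nat list"
    by (cases us) auto
  have "mset \<pi> = mset (sorted_list_of_set S) + mset (sorted_list_of_set ({1..n} - S))"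
    by (simp only: \<pi> right_canonical_def Let_def mset_place td add.assoc mset.simps mset_rev
          split: if_splits) simp
  then have m: "mset \<pi> = mset (sorted_list_of_set S @ sorted_list_of_set ({1..n} - S))"
    by simp
  have "set \<pi> = {1..n}"
    using mset_eq_setD[OF m] S fin by auto
  moreover have "distinct \<pi>"
    using mset_eq_imp_distinct_iff[OF m] fin by auto
  ultimately show "\<pi> \<in> perms n" by (simp add: permutations_of_set_def)
qed

end

theory Submission
  imports Defs
begin

text \<open>
  For odd \<open>n\<close> both families consist of the permutations with \<open>\<pi>\<^sub>1 < \<pi>\<^sub>2\<close> and
  \<open>\<pi>\<^sub>i < \<pi>\<^sub>i\<^sub>+\<^sub>2\<close> for all \<open>i\<close>; for even \<open>n\<close> one more entry, larger than its left neighbour,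
  is put at the right end. In such a \<open>\<pi>\<close> the pinnacles are exactly the descent tops, pinnacles
  and non-pinnacles increase separately from left to right, and an entry is a left-to-right
  maximum as soon as it exceeds its left neighbour. Hence the right-to-left filling from
  \<open>Pin \<pi>\<close> gives back \<open>\<pi>\<close>. Conversely, in an admissible set every \<open>s\<close> exceeds more
  non-pinnacles than there are pinnacles up to \<open>s\<close>, so that non-pinnacles never run out and the
  filling has this shape, with the given pinnacle set.
\<close>

section \<open>Right-to-left reading\<close>

text \<open>The filling rule without accumulator: entries are listed in the order of placement, that
  is, from right to left, so that structural induction applies.\<close>

fun merge_dec :: "nat list \<Rightarrow> nat list \<Rightarrow> nat list" where
  "merge_dec [] us = us"
| "merge_dec (s # ss) [] = s # ss"
| "merge_dec (s # ss) (u # us) =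
     (if u < s then u # s # merge_dec ss us else u # merge_dec (s # ss) us)"

lemma place_eq: "place ss us \<pi> = rev (merge_dec ss us) @ \<pi>"
  by (induction ss us \<pi> rule: place.induct) auto

text \<open>Lists are read from right to left here: the head is the last entry of the permutation.\<close>

fun zigzag :: "nat list \<Rightarrow> bool" where
  "zigzag (a # b # c # l) \<longleftrightarrow> c < a \<and> zigzag (b # c # l)"
| "zigzag [a, b] \<longleftrightarrow> b < a"
| "zigzag _ \<longleftrightarrow> True"

text \<open>Only the right neighbour \<open>a\<close> of \<open>b\<close> is tested, which finds
  descent tops. In a zigzag list the left neighbour of such a \<open>b\<close> is smaller as well,
  so both entries can be skipped.\<close>

fun peaks :: "nat list \<Rightarrow> nat list" where
  "peaks (a # b # l) = (if a < b then b # peaks l else peaks (b # l))"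
| "peaks _ = []"

fun rest :: "nat list \<Rightarrow> nat list" where
  "rest (a # b # l) = a # (if a < b then rest l else rest (b # l))"
| "rest l = l"

text \<open>With \<open>ss\<close> decreasing, \<open>length (s # ss)\<close> is the number of
  pinnacles up to \<open>s\<close>. Strictness leaves room for one non-pinnacle more than there are
  pinnacles.\<close>

fun ballot :: "nat list \<Rightarrow> nat list \<Rightarrow> bool" where
  "ballot [] us \<longleftrightarrow> True"
| "ballot (s # ss) us \<longleftrightarrow> length (s # ss) < length (filter (\<lambda>u. u < s) us) \<and> ballot ss us"

lemma zigzag_Cons: "zigzag (a # l) \<Longrightarrow> zigzag l"
  by (cases "a # l" rule: zigzag.cases) auto

text \<open>Moving back from \<open>x\<close> in steps of two only increases the value and ends at
  \<open>a\<close> or \<open>b\<close>.\<close>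

lemma zigzag_bound: "zigzag (a # b # l) \<Longrightarrow> x \<in> set l \<Longrightarrow> x < a \<or> x < b"
proof (induction "a # b # l" arbitrary: a b l rule: zigzag.induct)
  case (1 a b c l)
  then show ?case by (cases "x = c") auto
qed auto

lemma mset_peaks_rest: "mset (peaks l) + mset (rest l) = mset l"
  by (induction l rule: peaks.induct) auto

lemma set_peaks_subset: "set (peaks l) \<subseteq> set l"
  by (metis mset_peaks_rest set_mset_mono set_mset_mset mset_subset_eq_add_left)

lemma set_rest_subset: "set (rest l) \<subseteq> set l"
  by (metis mset_peaks_rest set_mset_mono set_mset_mset mset_subset_eq_add_right)

text \<open>By \<open>zigzag_bound\<close> the larger of the first two entries dominates all later
  ones. The names of this lemma and the next refer to the reversed list: a descent here is an ascent
  of the permutation.\<close>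

lemma zigzag_descent:
  assumes "zigzag (a # b # l)" "\<not> a < b" "distinct (a # b # l)" "x \<in> set (b # l)"
  shows "x < a"
  using assms zigzag_bound[of a b l x] by fastforce

lemma zigzag_ascent:
  assumes "zigzag (a # b # l)" "a < b" "x \<in> set l"
  shows "x < b"
  using assms zigzag_bound[of a b l x] by fastforce

text \<open>The comparison made by \<open>merge_dec\<close> has the same outcome as the comparison
  of neighbours by which \<open>peaks\<close> and \<open>rest\<close> split the list.\<close>

lemma merge_dec_peaks_rest:
  assumes "zigzag l" "distinct l"
  shows "merge_dec (peaks l) (rest l) = l"
  using assms
proof (induction l rule: peaks.induct)
  case (1 a b l)
  show ?case
  proof (cases "a < b")
    case True
    with 1 show ?thesis by (auto dest: zigzag_Cons)
  next
    case False
    with 1 have IH: "merge_dec (peaks (b # l)) (rest (b # l)) = b # l"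
      by (auto dest: zigzag_Cons)
    show ?thesis
    proof (cases "peaks (b # l)")
      case Nil
      with IH False show ?thesis by simp
    next
      case (Cons s ss)
      then have "s \<in> set (b # l)" using set_peaks_subset[of "b # l"] by auto
      \<comment> \<open>The next pinnacle lies below \<open>a\<close>, so the filling rule places
        \<open>a\<close> without a pinnacle after it.\<close>
      then have "s < a" using zigzag_descent 1 False by blast
      with Cons IH False show ?thesis by simp
    qed
  qed
qed auto

lemma peaks_decreasing:
  assumes "zigzag l" "distinct l"
  shows "sorted_wrt (>) (peaks l)"
  using assms
proof (induction l rule: peaks.induct)
  case (1 a b l)
  show ?case
  proof (cases "a < b")
    case True
    have "\<forall>x\<in>set (peaks l). x < b"
      using zigzag_ascent[OF 1(3) True] set_peaks_subset by blast
    with True 1 show ?thesis by (auto dest: zigzag_Cons)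
  next
    case False
    with 1 show ?thesis by (auto dest: zigzag_Cons)
  qed
qed auto

lemma rest_Cons: "\<exists>l'. rest (a # l) = a # l'"
  by (cases l) auto

lemma rest_decreasing:
  assumes "zigzag l" "distinct l"
  shows "sorted_wrt (>) (rest l)"
  using assms
proof (induction l rule: peaks.induct)
  case (1 a b l)
  show ?case
  proof (cases "a < b")
    case True
    \<comment> \<open>A third entry exists because \<open>zigzag [a, b]\<close> would force
      \<open>b < a\<close>. It is the head of \<open>rest l\<close>, and the zigzag condition puts
      it below \<open>a\<close>.\<close>
    with 1 obtain c l' where l: "l = c # l'" by (cases l) auto
    with 1 have ca: "c < a" by auto
    obtain l'' where l'': "rest l = c # l''" using rest_Cons l by blast
    have "sorted_wrt (>) (rest l)" using 1 True by (auto dest: zigzag_Cons)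
    with l'' ca have "\<forall>x\<in>set (rest l). x < a" by auto
    with True 1 show ?thesis by (auto dest: zigzag_Cons)
  next
    case False
    have "\<forall>x\<in>set (rest (b # l)). x < a"
      using zigzag_descent[OF 1(3) False 1(4)] set_rest_subset by blast
    with False 1 show ?thesis by (auto dest: zigzag_Cons)
  qed
qed auto

section \<open>Zigzag lists from merging under the ballot condition\<close>

lemma set_merge_dec: "set (merge_dec ss us) = set ss \<union> set us"
  by (induction ss us rule: merge_dec.induct) auto

lemma length_merge_dec: "length (merge_dec ss us) = length ss + length us"
  by (induction ss us rule: merge_dec.induct) auto

lemma zigzag_Cons_greatest: "zigzag l \<Longrightarrow> \<forall>x\<in>set l. x < a \<Longrightarrow> zigzag (a # l)"
  by (cases l rule: zigzag.cases) auto

lemma zigzag_if_decreasing: "sorted_wrt (>) l \<Longrightarrow> zigzag l \<and> peaks l = [] \<and> rest l = l"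
  by (induction l rule: zigzag.induct) auto

lemma merge_dec_hd:
  "us \<noteq> [] \<Longrightarrow> \<exists>l. merge_dec ss us = hd us # l"
  by (cases "(ss, us)" rule: merge_dec.cases) (auto simp: neq_Nil_conv)

text \<open>If \<open>u < s\<close>, then all of \<open>us\<close> lies below \<open>s\<close> and
  the length hypothesis suffices; otherwise \<open>u\<close> was not counted for
  \<open>s\<close>.\<close>

lemma ballot_drop:
  assumes "ballot ss us'" "us' = u # us" "sorted_wrt (>) us'"
    "length ss < length us"
  shows "ballot ss us"
  using assms
proof (induction ss us' rule: ballot.induct)
  case (2 s ss us')
  have "length (s # ss) < length (filter (\<lambda>v. v < s) us)"
  proof (cases "u < s")
    case True
    then have "filter (\<lambda>v. v < s) us = us" using 2 by (auto simp: filter_id_conv)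
    with 2 show ?thesis by simp
  next
    case False
    with 2 show ?thesis by auto
  qed
  with 2 show ?case by auto
qed auto

text \<open>A pinnacle \<open>s\<close> placed after some \<open>u < s\<close> exceeds everything
  left, and so does a \<open>u > s\<close> placed alone. The ballot condition rules out that
  \<open>us\<close> is exhausted first. Hence the output is zigzag, and \<open>peaks\<close> and
  \<open>rest\<close> retrace the choices made.\<close>

lemma merge_dec_inverse:
  assumes "ballot ss us" "sorted_wrt (>) ss" "sorted_wrt (>) us" "set ss \<inter> set us = {}"
  shows "zigzag (merge_dec ss us) \<and> peaks (merge_dec ss us) = ss \<and> rest (merge_dec ss us) = us"
  using assms
proof (induction ss us rule: merge_dec.induct)
  case (1 us)
  then show ?case by (simp add: zigzag_if_decreasing)
next
  case (2 s ss)
  then show ?case by simp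
next
  case (3 s ss u us)
  show ?case
  proof (cases "u < s")
    case True
    have len: "length ss < length us"
      using 3(3) True by (auto intro: less_le_trans[OF _ length_filter_le])
    then have "ballot ss us" using ballot_drop 3(3,5) by (metis ballot.simps(2))
    with 3 True have IH: "zigzag (merge_dec ss us)" "peaks (merge_dec ss us) = ss"
      "rest (merge_dec ss us) = us" by auto
    \<comment> \<open>The entry following \<open>u\<close> and \<open>s\<close> is the non-pinnacle
      \<open>hd us\<close>, which is below \<open>u\<close>, as the step of two over
      \<open>s\<close> requires.\<close>
    from len obtain l where l: "merge_dec ss us = hd us # l" and ne: "us \<noteq> []"
      using merge_dec_hd[of us ss] by fastforce
    have "\<forall>x\<in>set (merge_dec ss us). x < s"
      using 3(4,5) True by (auto simp: set_merge_dec)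
    with IH(1) have "zigzag (s # merge_dec ss us)" by (rule zigzag_Cons_greatest)
    moreover have "hd us < u" using 3(5) ne by (cases us) auto
    ultimately have "zigzag (u # s # merge_dec ss us)" by (simp add: l)
    with IH True show ?thesis by simp
  next
    case False
    with 3 have su: "s < u" by auto
    then have "ballot (s # ss) us"
    proof -
      \<comment> \<open>An entry \<open>u\<close> above all pinnacles contributes to none of the
        counts.\<close>
      have *: "ballot ts (u # us) \<Longrightarrow> \<forall>t\<in>set ts. t < u \<Longrightarrow> ballot ts us" for ts
        by (induction ts) auto
      show ?thesis by (rule *) (use 3 su in auto)
    qed
    with 3 False have IH: "zigzag (merge_dec (s # ss) us)" "peaks (merge_dec (s # ss) us) = s # ss"
      "rest (merge_dec (s # ss) us) = us" by auto
    have g: "\<forall>x\<in>set (merge_dec (s # ss) us). x < u"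
      using 3 su by (auto simp: set_merge_dec)
    obtain b l where l: "merge_dec (s # ss) us = b # l"
      using length_merge_dec[of "s # ss" us] by (cases "merge_dec (s # ss) us") auto
    have "zigzag (u # merge_dec (s # ss) us)" using IH(1) g by (rule zigzag_Cons_greatest)
    with False IH g l show ?thesis by auto
  qed
qed

section \<open>Pinnacle sets\<close>

definition peak_at :: "nat list \<Rightarrow> nat \<Rightarrow> bool" where
  "peak_at \<pi> i \<longleftrightarrow> 0 < i \<and> i + 1 < length \<pi> \<and> \<pi> ! (i - 1) < \<pi> ! i \<and> \<pi> ! (i + 1) < \<pi> ! i"

lemma Pin_alt: "Pin \<pi> = (!) \<pi> ` {i. peak_at \<pi> i}"
proof
  show "Pin \<pi> \<subseteq> (!) \<pi> ` {i. peak_at \<pi> i}"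
  proof
    fix x assume "x \<in> Pin \<pi>"
    then obtain i where i: "x = \<pi> ! (i - 1)" "2 \<le> i" "i \<le> length \<pi> - 1"
      "\<pi> ! (i - 2) < \<pi> ! (i - 1)" "\<pi> ! (i - 1) > \<pi> ! i" unfolding Pin_def by blast
    have "i - 1 - 1 = i - 2" "i - 1 + 1 = i" using i by auto
    with i have "peak_at \<pi> (i - 1)" by (simp add: peak_at_def)
    with i(1) show "x \<in> (!) \<pi> ` {i. peak_at \<pi> i}" by blast
  qed
  show "(!) \<pi> ` {i. peak_at \<pi> i} \<subseteq> Pin \<pi>"
  proof
    fix x assume "x \<in> (!) \<pi> ` {i. peak_at \<pi> i}"
    then obtain i where "x = \<pi> ! i" "peak_at \<pi> i" by blast
    then show "x \<in> Pin \<pi>"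
      unfolding Pin_def peak_at_def by (intro CollectI exI[of _ "i + 1"]) auto
  qed
qed

text \<open>Appending \<open>a\<close> makes just one position interior, that of \<open>b\<close>,
  so \<open>b\<close> is the only candidate for a new pinnacle.\<close>

lemma Pin_snoc:
  "Pin (l @ [c, b, a]) = Pin (l @ [c, b]) \<union> (if c < b \<and> a < b then {b} else {})"
proof -
  let ?p = "l @ [c, b, a]" and ?q = "l @ [c, b]"
  have eq: "?p ! i = ?q ! i" if "i < length ?q" for i
    using that by (auto simp: nth_append nth_Cons' less_Suc_eq)
  have 1: "peak_at ?p i \<longleftrightarrow> peak_at ?q i" if "i < length l + 1" for i
    using that eq[of i] eq[of "i - 1"] eq[of "i + 1"] by (auto simp: peak_at_def)
  have 2: "peak_at ?p (length l + 1) \<longleftrightarrow> c < b \<and> a < b"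
    by (simp add: nth_append peak_at_def)
  have "peak_at ?p i \<longleftrightarrow> peak_at ?q i \<or> (i = length l + 1 \<and> c < b \<and> a < b)" for i
  proof (cases "i < length l + 1")
    case True
    then show ?thesis using 1[of i] by blast
  next
    case False
    then have "\<not> peak_at ?q i" "i \<noteq> length l + 1 \<Longrightarrow> \<not> peak_at ?p i"
      by (auto simp: peak_at_def)
    with 2 show ?thesis by blast
  qed
  then have "{i. peak_at ?p i} =
      {i. peak_at ?q i} \<union> (if c < b \<and> a < b then {length l + 1} else {})"
    by auto
  moreover have "(!) ?p ` {i. peak_at ?q i} = (!) ?q ` {i. peak_at ?q i}"
    by (intro image_cong refl eq) (simp add: peak_at_def)
  moreover have "?p ! (length l + 1) = b" by (simp add: nth_append)
  ultimately show ?thesis by (simp only: Pin_alt image_Un image_insert image_empty if_distrib[of "\<lambda>A. (!) ?p ` A"])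
qed

lemma Pin_short: "length \<pi> < 3 \<Longrightarrow> Pin \<pi> = {}"
  by (auto simp: Pin_alt peak_at_def)

lemma Pin_snoc_greater:
  assumes "b < a"
  shows "Pin (rev l @ [b, a]) = Pin (rev l @ [b])"
proof (cases l)
  case (Cons c k)
  with assms Pin_snoc[of "rev k" c b a] show ?thesis by simp
qed (simp add: Pin_short)

text \<open>For \<open>a < b\<close> the zigzag condition yields a left neighbour
  \<open>c < a < b\<close>, so \<open>b\<close> is a pinnacle. Removing \<open>b\<close> then loses
  no other pinnacle, by \<open>Pin_snoc_greater\<close> with \<open>c < b\<close>.\<close>

lemma Pin_rev_zigzag:
  assumes "zigzag l" "distinct l"
  shows "Pin (rev l) = set (peaks l)"
  using assms
proof (induction l rule: peaks.induct)
  case (1 a b l)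
  show ?case
  proof (cases "a < b")
    case True
    with 1 obtain c k where l: "l = c # k" by (cases l) auto
    with True 1 have cb: "c < b" by auto
    have "Pin (rev (a # b # l)) = insert b (Pin (rev k @ [c, b]))"
      using Pin_snoc[of "rev k" c b a] True cb l by simp
    also have "Pin (rev k @ [c, b]) = Pin (rev l)"
      using Pin_snoc_greater[OF cb] l by simp
    finally show ?thesis using 1 True by (auto dest: zigzag_Cons)
  next
    case False
    with 1 have "b < a" by auto
    with Pin_snoc_greater[OF this] 1 False show ?thesis by (auto dest: zigzag_Cons)
  qed
qed (auto simp: Pin_short)

text \<open>The entries next to the \<open>d\<close> pinnacles up to \<open>s\<close> fill at least \<open>d + 1\<close> positions: the one
  just before the first of these pinnacles and the one just after each.\<close>

lemma admissible_card:
  assumes "admissible S" "s \<in> S"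
  shows "card {x \<in> S. x \<le> s} < card {x. 1 \<le> x \<and> x < s \<and> x \<notin> S}"
proof -
  \<comment> \<open>The permutation realising \<open>S\<close> may have any length; the count
    concerns only values below \<open>s\<close> and so does not depend on that length.\<close>
  from assms obtain n \<pi> where \<pi>: "\<pi> \<in> perms n" and S: "S = Pin \<pi>"
    by (auto simp: admissible_def)
  have dis: "distinct \<pi>" and set: "set \<pi> = {1..n}" using \<pi> by (auto simp: permutations_of_set_def)
  have SP: "S = (!) \<pi> ` {i. peak_at \<pi> i}" by (simp add: S Pin_alt)
  define I where "I = {i. peak_at \<pi> i \<and> \<pi> ! i \<le> s}"
  have fI: "finite I" by (rule finite_subset[of _ "{..<length \<pi>}"]) (auto simp: I_def peak_at_def)
  from assms SP have neI: "I \<noteq> {}" by (auto simp: I_def)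
  define J where "J = insert (Min I - 1) (Suc ` I)"
  have m: "Min I \<in> I" using fI neI by simp
  have "Min I - 1 \<notin> Suc ` I"
    using Min_le[OF fI] by fastforce
  then have cJ: "card J = Suc (card I)" using fI by (simp add: J_def card_image)
  have J: "\<exists>i\<in>I. j = i - 1 \<or> j = i + 1" if "j \<in> J" for j
    using that m by (auto simp: J_def)
  have lenJ: "j < length \<pi>" if "j \<in> J" for j
    using J[OF that] by (auto simp: I_def peak_at_def)
  \<comment> \<open>A neighbour of a pinnacle is smaller than it, hence not a pinnacle itself and
    below \<open>s\<close>.\<close>
  have notP: "\<not> peak_at \<pi> j \<and> \<pi> ! j < s" if "j \<in> J" for j
    using J[OF that] by (auto simp: I_def peak_at_def)
  have inj: "i = j" if "\<pi> ! i = \<pi> ! j" "i < length \<pi>" "j < length \<pi>" for i j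
    using that dis nth_eq_iff_index_eq by blast
  have "(!) \<pi> ` J \<subseteq> {x. 1 \<le> x \<and> x < s \<and> x \<notin> S}"
  proof
    fix x assume "x \<in> (!) \<pi> ` J"
    then obtain j where j: "j \<in> J" "x = \<pi> ! j" by auto
    then have "x \<in> {1..n}" using lenJ set nth_mem by blast
    moreover have "x \<notin> S"
    proof
      assume "x \<in> S"
      then obtain i where "peak_at \<pi> i" "\<pi> ! i = \<pi> ! j" using SP j by auto
      then have "i = j" using inj lenJ[OF j(1)] by (auto simp: peak_at_def)
      with \<open>peak_at \<pi> i\<close> notP j show False by auto
    qed
    ultimately show "x \<in> {x. 1 \<le> x \<and> x < s \<and> x \<notin> S}" using notP j by auto
  qed
  moreover have "inj_on ((!) \<pi>) J" using lenJ inj by (auto intro!: inj_onI)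
  ultimately have "card J \<le> card {x. 1 \<le> x \<and> x < s \<and> x \<notin> S}"
    by (intro card_inj_on_le) auto
  moreover have "{x \<in> S. x \<le> s} = (!) \<pi> ` I" by (auto simp: SP I_def)
  then have "card {x \<in> S. x \<le> s} \<le> card I" using fI card_image_le by metis
  ultimately show ?thesis using cJ by simp
qed

text \<open>As \<open>ss\<close> is decreasing, the elements up to one of its entries are that entry
  and its successors, so the cardinalities become list lengths.\<close>

lemma ballotI:
  assumes "sorted_wrt (>) ss" "distinct us"
    "\<And>s. s \<in> set ss \<Longrightarrow> card {x \<in> set ss. x \<le> s} < card {u \<in> set us. u < s}"
  shows "ballot ss us"
  using assms
proof (induction ss)
  case (Cons s ss)
  have "{x \<in> set (s # ss). x \<le> s} = set (s # ss)" using Cons by auto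
  moreover have "distinct (s # ss)" using Cons(2) by (metis strict_sorted_iff sorted_wrt_rev distinct_rev
    rev_rev_ident sorted_wrt_mono_rel)
  ultimately have "card {x \<in> set (s # ss). x \<le> s} = length (s # ss)"
    by (metis distinct_card)
  moreover have "card {u \<in> set us. u < s} = length (filter (\<lambda>u. u < s) us)"
    using Cons(3) by (metis distinct_card distinct_filter set_filter)
  ultimately have "length (s # ss) < length (filter (\<lambda>u. u < s) us)"
    using Cons(4)[of s] by simp
  moreover have "ballot ss us"
  proof (rule Cons.IH)
    fix t assume t: "t \<in> set ss"
    then have "t < s" using Cons(2) by auto
    then have "{x \<in> set (s # ss). x \<le> t} = {x \<in> set ss. x \<le> t}" by auto
    with Cons(4)[of t] t show "card {x \<in> set ss. x \<le> t} < card {u \<in> set us. u < t}" by simp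
  qed (use Cons in auto)
  ultimately show ?case by simp
qed simp


section \<open>Right canonical permutations\<close>

lemma rev_sorted_list_of_set:
  "sorted_wrt (>) l \<Longrightarrow> rev (sorted_list_of_set (set l)) = (l :: nat list)"
  by (metis rev_rev_ident set_rev sorted_list_of_set.idem_if_sorted_distinct sorted_wrt_rev
      strict_sorted_iff)

text \<open>For even \<open>n\<close> the zigzag pattern starts only at the second entry from the right.\<close>

definition alternating :: "nat list \<Rightarrow> bool" where
  "alternating \<pi> \<longleftrightarrow> (if odd (length \<pi>) then zigzag (rev \<pi>)
     else zigzag (tl (rev \<pi>)) \<and> hd (tl (rev \<pi>)) < hd (rev \<pi>))"

lemma length_perms: "\<pi> \<in> perms n \<Longrightarrow> length \<pi> = n"
  by (auto simp: permutations_of_set_def distinct_card[symmetric])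

text \<open>\<open>admissible_card\<close> gives the ballot condition, and
  \<open>merge_dec_inverse\<close> gives the shape and the pinnacles. For even \<open>n\<close> the
  extra last entry exceeds its left neighbour and so changes no pinnacle.\<close>

lemma right_canonical_alternating:
  assumes "n \<ge> 1" "S \<subseteq> {1..n}" "admissible S"
  shows "alternating (right_canonical n S) \<and> Pin (right_canonical n S) = S"
proof -
  define ss where "ss = rev (sorted_list_of_set S)"
  define us where "us = rev (sorted_list_of_set ({1..n} - S))"
  have fin: "finite S" using assms(2) finite_subset by blast
  have ss: "sorted_wrt (>) ss" "set ss = S" and us: "sorted_wrt (>) us" "set us = {1..n} - S" "distinct us"
    using fin by (auto simp: ss_def us_def sorted_wrt_rev)
  have "right_canonical n S \<in> perms n"
    using right_canonical_perms_subset assms by (auto simp: right_canonical_perms_def)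
  then have dis: "distinct (right_canonical n S)" and len: "length (right_canonical n S) = n"
    by (auto simp: length_perms permutations_of_set_def)
  have ballot: "ballot ss us"
  proof (rule ballotI)
    fix s assume s: "s \<in> set ss"
    then have "{u \<in> set us. u < s} = {x. 1 \<le> x \<and> x < s \<and> x \<notin> S}"
      using ss us assms(2) by fastforce
    with s ss admissible_card[OF assms(3), of s]
    show "card {x \<in> set ss. x \<le> s} < card {u \<in> set us. u < s}" by simp
  qed (use ss us in auto)
  show ?thesis
  proof (cases "odd n")
    case True
    then have eq: "right_canonical n S = rev (merge_dec ss us)"
      by (simp add: right_canonical_def ss_def us_def place_eq)
    have "zigzag (merge_dec ss us)" "peaks (merge_dec ss us) = ss"
      using merge_dec_inverse[OF ballot] ss us by auto
    then show ?thesis using Pin_rev_zigzag[of "merge_dec ss us"] True len dis ss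
      by (simp add: alternating_def eq)
  next
    case False
    have n: "length ss + length us = n"
      using fin assms(2) card_mono[OF _ assms(2)] by (simp add: ss_def us_def card_Diff_subset)
    have "length ss < length us"
    proof (cases ss)
      case (Cons s ts)
      with ballot show ?thesis by (auto intro: Suc_lessD less_le_trans[OF _ length_filter_le])
    qed (use n assms(1) in simp)
    \<comment> \<open>The two lengths add up to the even number \<open>n\<close>, so they differ by
      at least 2, and non-pinnacles remain in the majority once the largest is placed at the right
      end.\<close>
    moreover have "length us \<noteq> length ss + 1" using False n by auto
    ultimately obtain u vs where u: "us = u # vs" and lt: "length ss < length vs"
      by (cases us) auto
    have eq: "right_canonical n S = rev (merge_dec ss vs) @ [u]"
      using False u
      unfolding right_canonical_def Let_def ss_def[symmetric] us_def[symmetric] by (simp add: place_eq)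
    have "ballot ss vs" using ballot_drop[OF ballot u us(1) lt] .
    then have m: "zigzag (merge_dec ss vs)" "peaks (merge_dec ss vs) = ss"
      using merge_dec_inverse[of ss vs] ss us u by auto
    have "vs \<noteq> []" using lt by auto
    then obtain l where l: "merge_dec ss vs = hd vs # l" using merge_dec_hd by blast
    have lt: "hd vs < u" using us(1) u \<open>vs \<noteq> []\<close> by auto
    have "Pin (right_canonical n S) = Pin (rev (merge_dec ss vs))"
      using Pin_snoc_greater[OF lt, of l] by (simp add: eq l)
    also have "\<dots> = S" using Pin_rev_zigzag[OF m(1)] m(2) ss dis eq by simp
    finally show ?thesis using False len m lt by (simp add: alternating_def eq l)
  qed
qed

lemma set_rest:
  assumes "distinct l"
  shows "set (rest l) = set l - set (peaks l)"
proof -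
  have "mset (peaks l @ rest l) = mset l" by (simp add: mset_peaks_rest)
  then have "distinct (peaks l @ rest l)" "set (peaks l @ rest l) = set l"
    using assms mset_eq_imp_distinct_iff mset_eq_setD by blast+
  then show ?thesis by auto
qed

text \<open>A decreasing list is determined by its set, so the filling starts from
  \<open>peaks\<close> and \<open>rest\<close> themselves, and \<open>merge_dec_peaks_rest\<close>
  applies.\<close>

lemma right_canonical_Pin:
  assumes "n \<ge> 1" "\<pi> \<in> perms n" "alternating \<pi>"
  shows "right_canonical n (Pin \<pi>) = \<pi>"
proof -
  have dis: "distinct \<pi>" and set: "set \<pi> = {1..n}" and len: "length \<pi> = n"
    using assms by (auto simp: permutations_of_set_def length_perms)
  show ?thesis
  proof (cases "odd n")
    case True
    define l where "l = rev \<pi>"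
    have z: "zigzag l" and d: "distinct l" and pi: "\<pi> = rev l"
      using True assms len dis by (auto simp: alternating_def l_def)
    have S: "Pin \<pi> = set (peaks l)" using Pin_rev_zigzag[OF z d] pi by simp
    have "{1..n} - Pin \<pi> = set (rest l)" using set_rest[OF d] S set pi by auto
    then show ?thesis
      using True S rev_sorted_list_of_set peaks_decreasing[OF z d] rest_decreasing[OF z d]
        merge_dec_peaks_rest[OF z d] pi
      by (simp add: right_canonical_def place_eq)
  next
    case False
    with assms(1) len obtain a b l where l: "rev \<pi> = a # b # l"
      by (cases "rev \<pi>" rule: zigzag.cases) (auto simp flip: length_rev[of \<pi>])
    then have pi: "\<pi> = rev (b # l) @ [a]" by (metis rev.simps(2) rev_rev_ident)
    have z: "zigzag (b # l)" and ba: "b < a" and d: "distinct (b # l)" and a: "a \<notin> set (b # l)"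
      using False assms len dis l by (auto simp: alternating_def pi)
    have S: "Pin \<pi> = set (peaks (b # l))"
      using Pin_rev_zigzag[OF z d] Pin_snoc_greater[OF ba, of l] by (simp add: pi)
    then have U: "{1..n} - Pin \<pi> = set (a # rest (b # l))"
      using set_rest[OF d] set pi a set_peaks_subset[of "b # l"] by auto
    \<comment> \<open>Since \<open>rest\<close> starts with \<open>b < a\<close>, prefixing
      \<open>a\<close> keeps it decreasing; thus \<open>a\<close> is the entry that is placed
      without comparison.\<close>
    obtain l' where "rest (b # l) = b # l'" using rest_Cons by blast
    with rest_decreasing[OF z d] ba have "sorted_wrt (>) (a # rest (b # l))" by auto
    from rev_sorted_list_of_set[OF this] show ?thesis
      using False S U rev_sorted_list_of_set peaks_decreasing[OF z d]
        merge_dec_peaks_rest[OF z d] pi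
      by (simp add: right_canonical_def place_eq)
  qed
qed

section \<open>Interleaved permutations\<close>

lemma fill_strict_mono:
  assumes "finite P" "finite V" "card P = card V" "i \<in> P" "j \<in> P" "i < j"
  shows "fill P V i < fill P V j"
proof -
  have "card {k \<in> P. k < i} < card {k \<in> P. k < j}"
    using assms by (intro psubset_card_mono) auto
  moreover have "card {k \<in> P. k < j} < card P"
    using assms by (intro psubset_card_mono) auto
  ultimately show ?thesis
    using assms by (auto simp: fill_def intro!: sorted_wrt_nth_less[OF strict_sorted_list_of_set])
qed

lemma sorted_list_of_set_rank:
  assumes "finite V" "x \<in> V"
  shows "sorted_list_of_set V ! card {y \<in> V. y < x} = (x :: nat)"
proof -
  define xs where "xs = sorted_list_of_set V"
  have V: "set xs = V" and dis: "distinct xs" and sorted: "sorted_wrt (<) xs"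
    using assms(1) by (auto simp: xs_def)
  obtain k where k: "k < length xs" "xs ! k = x"
    using assms(2) V by (metis in_set_conv_nth)
  have less: "xs ! i < xs ! j \<longleftrightarrow> i < j" if "i < length xs" "j < length xs" for i j
    using that sorted_wrt_nth_less[OF sorted, of i j] sorted_wrt_nth_less[OF sorted, of j i]
    by (cases i j rule: linorder_cases) auto
  have "{y \<in> V. y < x} = (!) xs ` {..<k}"
  proof (intro set_eqI iffI)
    fix y assume "y \<in> {y \<in> V. y < x}"
    then obtain j where "j < length xs" "xs ! j = y" "y < x"
      using V by (auto simp: in_set_conv_nth)
    with less[of j k] k show "y \<in> (!) xs ` {..<k}" by auto
  next
    fix y assume "y \<in> (!) xs ` {..<k}"
    then obtain j where "j < k" "y = xs ! j" by auto
    with less[of j k] k V nth_mem[of j xs] show "y \<in> {y \<in> V. y < x}" by auto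
  qed
  also have "card \<dots> = k"
    using k(1) dis by (subst card_image) (auto simp: inj_on_def nth_eq_iff_index_eq)
  finally show ?thesis using k by (simp add: xs_def)
qed

text \<open>An increasing \<open>f\<close> preserves ranks, and the element of rank \<open>r\<close>
  stands at index \<open>r\<close> of the sorted list.\<close>

lemma fill_unique:
  assumes "finite P" "\<And>i j. i \<in> P \<Longrightarrow> j \<in> P \<Longrightarrow> i < j \<Longrightarrow> f i < f j" "i \<in> P"
  shows "fill P (f ` P) i = f i"
proof -
  have *: "f j < f i \<longleftrightarrow> j < i" if "j \<in> P" for j
    using assms(2)[of i j] assms(2)[of j i] assms(3) that
    by (cases i j rule: linorder_cases) auto
  have "inj_on f P" by (rule linorder_inj_onI) (use assms(2) in force)+
  have "{y \<in> f ` P. y < f i} = f ` {j \<in> P. j < i}" using * by auto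
  then have "card {y \<in> f ` P. y < f i} = card {j \<in> P. j < i}"
    using \<open>inj_on f P\<close> by (simp add: card_image inj_on_def)
  with sorted_list_of_set_rank[of "f ` P" "f i"] assms show ?thesis
    by (simp add: fill_def)
qed

text \<open>The bound \<open>(n - 1) div 2\<close> stops strictly below \<open>n\<close>, so
  position \<open>n\<close> is excluded even when \<open>n\<close> is even.\<close>

lemma even_positions_iff: "i \<in> even_positions n \<longleftrightarrow> even i \<and> 0 < i \<and> i < n"
  by (auto simp: even_positions_def elim!: evenE)

lemma even_positions_facts:
  "finite (even_positions n)" "even_positions n \<subseteq> {1..n}"
  "card (even_positions n) = (n - 1) div 2"
proof -
  have "even_positions n = (\<lambda>k. 2 * k) ` {1..(n - 1) div 2}"
    by (auto simp: even_positions_def)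
  then show "card (even_positions n) = (n - 1) div 2"
    by (simp add: card_image inj_on_def)
  show "even_positions n \<subseteq> {1..n}" by (auto simp: even_positions_iff)
  then show "finite (even_positions n)" using finite_subset by blast
qed

lemma card_odd_positions:
  assumes "A \<subseteq> {2..n}" "card A = (n - 1) div 2"
  shows "card ({1..n} - even_positions n) = card ({1..n} - A)"
proof -
  have "A \<subseteq> {1..n}" "finite A" using assms(1) finite_subset by fastforce+
  then show ?thesis using assms even_positions_facts[of n] by (simp add: card_Diff_subset)
qed

lemma interleaved_nth:
  "i < n \<Longrightarrow> interleaved n A ! i =
     (if i + 1 \<in> even_positions n then fill (even_positions n) A (i + 1)
      else fill ({1..n} - even_positions n) ({1..n} - A) (i + 1))"
  by (simp add: interleaved_def del: upt_Suc)

lemma set_even_positions_interleaved: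
  assumes "A \<subseteq> {2..n}" "card A = (n - 1) div 2"
  shows "(\<lambda>i. interleaved n A ! (i - 1)) ` even_positions n = A"
proof -
  have "(\<lambda>i. interleaved n A ! (i - 1)) ` even_positions n = fill (even_positions n) A ` even_positions n"
    by (intro image_cong) (auto simp: interleaved_nth even_positions_iff)
  also have "\<dots> = A"
    using assms even_positions_facts[of n] finite_subset[of A "{2..n}"] by (intro fill_image) auto
  finally show ?thesis .
qed

text \<open>\<open>A\<close> can be read off at the even positions, so \<open>interleaved n\<close>
  is injective on the subsets of the (n-1)-element set \<open>{2..n}\<close> of the right
  size.\<close>

lemma card_interleaved_perms:
  assumes "n \<ge> 1"
  shows "card (interleaved_perms n) = (n - 1) choose ((n - 1) div 2)"
proof -
  let ?\<A> = "{A. A \<subseteq> {2..n} \<and> card A = (n - 1) div 2}"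
  have "interleaved_perms n = interleaved n ` ?\<A>"
    by (auto simp: interleaved_perms_def)
  moreover have "inj_on (interleaved n) ?\<A>"
    by (rule inj_on_inverseI[where g = "\<lambda>\<pi>. (\<lambda>i. \<pi> ! (i - 1)) ` even_positions n"])
      (simp only: set_even_positions_interleaved mem_Collect_eq)
  ultimately show ?thesis by (simp add: card_image n_subsets)
qed

definition class_increasing :: "nat \<Rightarrow> nat list \<Rightarrow> bool" where
  "class_increasing n \<pi> \<longleftrightarrow> (\<forall>i j. i < j \<longrightarrow> j < n \<longrightarrow>
     (i + 1 \<in> even_positions n \<longleftrightarrow> j + 1 \<in> even_positions n) \<longrightarrow> \<pi> ! i < \<pi> ! j)"

text \<open>Increase within each class of positions says that both classes are filled as by
  \<open>fill\<close>; the entry 1 in front says that 1 is not in \<open>A\<close>.\<close>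

lemma interleaved_perms_iff:
  assumes "n \<ge> 1"
  shows "\<pi> \<in> interleaved_perms n \<longleftrightarrow> \<pi> \<in> perms n \<and> \<pi> ! 0 = 1 \<and> class_increasing n \<pi>"
proof
  let ?E = "even_positions n"
  let ?O = "{1..n} - ?E"
  assume \<pi>: "\<pi> \<in> interleaved_perms n"
  then obtain A where A: "A \<subseteq> {2..n}" "card A = (n - 1) div 2" and eq: "\<pi> = interleaved n A"
    by (auto simp: interleaved_perms_def)
  have fA: "finite A" using A finite_subset by blast
  have inc: "class_increasing n \<pi>"
    unfolding class_increasing_def
  proof (intro allI impI)
    fix i j assume ij: "i < j" "j < n" "(i + 1 \<in> ?E) = (j + 1 \<in> ?E)"
    show "\<pi> ! i < \<pi> ! j"
    proof (cases "i + 1 \<in> ?E")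
      case True
      with ij show ?thesis
        using even_positions_facts[of n] A fA by (auto simp: eq interleaved_nth intro!: fill_strict_mono)
    next
      case False
      with ij show ?thesis
        using card_odd_positions[OF A] by (auto simp: eq interleaved_nth intro!: fill_strict_mono)
    qed
  qed
  \<comment> \<open>\<open>fill\<close> is onto, so 1 occurs at some \<open>j\<close> outside the
    even positions; by monotonicity the entry at position 1 is at most that.\<close>
  have "fill ?O ({1..n} - A) ` ?O = {1..n} - A"
    using card_odd_positions[OF A] by (intro fill_image) auto
  moreover have "1 \<in> {1..n} - A" using A assms by auto
  ultimately obtain j where j: "j \<in> ?O" "fill ?O ({1..n} - A) j = 1" by (metis imageE)
  have one: "1 \<in> ?O" using assms by (auto simp: even_positions_iff)
  have "fill ?O ({1..n} - A) 1 \<le> 1"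
  proof (cases "j = 1")
    case False
    with j have "fill ?O ({1..n} - A) 1 < fill ?O ({1..n} - A) j"
      using card_odd_positions[OF A] one by (intro fill_strict_mono) auto
    with j show ?thesis by simp
  qed (use j in simp)
  then have "\<pi> ! 0 \<le> 1" using assms one by (simp add: eq interleaved_nth)
  moreover have "\<pi> \<in> perms n" using \<pi> interleaved_perms_subset by blast
  then have "\<pi> ! 0 \<in> {1..n}"
    using assms length_perms nth_mem[of 0 \<pi>] by (auto simp: permutations_of_set_def)
  ultimately show "\<pi> \<in> perms n \<and> \<pi> ! 0 = 1 \<and> class_increasing n \<pi>"
    using inc \<open>\<pi> \<in> perms n\<close> by auto
next
  let ?E = "even_positions n"
  let ?O = "{1..n} - ?E"
  let ?f = "\<lambda>i. \<pi> ! (i - 1)"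
  assume \<pi>: "\<pi> \<in> perms n \<and> \<pi> ! 0 = 1 \<and> class_increasing n \<pi>"
  then have set: "set \<pi> = {1..n}" and dis: "distinct \<pi>" and len: "length \<pi> = n"
    by (auto simp: permutations_of_set_def length_perms)
  define A where "A = ?f ` ?E"
  have inj: "inj_on ?f {1..n}"
    using dis len by (auto intro!: inj_onI simp: nth_eq_iff_index_eq)
  have im: "?f ` {1..n} = {1..n}"
  proof -
    have "?f ` {1..n} = (!) \<pi> ` {..<n}"
      by (simp only: image_Suc_lessThan[symmetric] image_image diff_Suc_1)
    then show ?thesis using nth_image[of n \<pi>] set len by (simp add: atLeast0LessThan)
  qed
  have O: "{1..n} - A = ?f ` ?O"
    using inj_on_image_set_diff[OF inj, of "{1..n}" ?E] im even_positions_facts(2)[of n]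
    by (auto simp: A_def)
  have cA: "card A = (n - 1) div 2"
    using inj even_positions_facts[of n] by (simp add: A_def card_image inj_on_subset)
  have "1 \<notin> A"
  proof
    assume "1 \<in> A"
    then obtain i where "i \<in> ?E" "?f i = ?f 1" using \<pi> by (auto simp: A_def)
    then have "i = 1" using inj_onD[OF inj, of i 1] even_positions_facts(2)[of n] assms by auto
    with \<open>i \<in> ?E\<close> show False by (simp add: even_positions_iff)
  qed
  moreover have "A \<subseteq> {1..n}" unfolding A_def using even_positions_facts(2)[of n] im by blast
  moreover have "{2..n} = {1..n} - {1}" by auto
  ultimately have sA: "A \<subseteq> {2..n}" by blast
  have inc: "?f i < ?f j" if "i < j" "i \<in> {1..n}" "j \<in> {1..n}" "(i \<in> ?E) = (j \<in> ?E)" for i j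
  proof -
    have "i - 1 < j - 1" "j - 1 < n" "(i - 1) + 1 = i" "(j - 1) + 1 = j" using that by auto
    with \<pi> that(4) show ?thesis unfolding class_increasing_def by metis
  qed
  have "\<pi> = interleaved n A"
  proof (rule nth_equalityI)
    show "length \<pi> = length (interleaved n A)" by (simp add: len interleaved_def)
    fix k assume k: "k < length \<pi>"
    have "fill ?E A (k + 1) = \<pi> ! k" if "k + 1 \<in> ?E"
      using fill_unique[of ?E ?f "k + 1"] that inc even_positions_facts[of n]
      by (auto simp: A_def subset_iff)
    moreover have "fill ?O ({1..n} - A) (k + 1) = \<pi> ! k" if "k + 1 \<notin> ?E"
    proof -
      have "fill ?O (?f ` ?O) (k + 1) = ?f (k + 1)"
        by (rule fill_unique) (use that inc k len in auto)
      then show ?thesis by (simp only: O add_diff_cancel_right')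
    qed
    ultimately show "\<pi> ! k = interleaved n A ! k" using k len by (simp add: interleaved_nth)
  qed
  with sA cA show "\<pi> \<in> interleaved_perms n" by (auto simp: interleaved_perms_def)
qed

section \<open>Alternating permutations described by indices\<close>

definition two_step :: "nat list \<Rightarrow> bool" where
  "two_step \<pi> \<longleftrightarrow> (\<forall>i. i + 2 < length \<pi> \<longrightarrow> \<pi> ! i < \<pi> ! (i + 2)) \<and>
     (1 < length \<pi> \<longrightarrow> \<pi> ! 0 < \<pi> ! 1)"

lemma two_step_snoc:
  assumes "2 \<le> length l"
  shows "two_step (l @ [a]) \<longleftrightarrow> two_step l \<and> l ! (length l - 2) < a"
proof -
  have "(\<forall>i. i + 2 < length (l @ [a]) \<longrightarrow> (l @ [a]) ! i < (l @ [a]) ! (i + 2)) \<longleftrightarrow>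
    (\<forall>i. i + 2 < length l \<longrightarrow> l ! i < l ! (i + 2)) \<and> l ! (length l - 2) < a" (is "?L \<longleftrightarrow> ?R")
  proof
    assume L: ?L
    then have "l ! i < l ! (i + 2)" if "i + 2 < length l" for i
      using L[rule_format, of i] that by (simp add: nth_append)
    moreover have "l ! (length l - 2) < a"
      using L[rule_format, of "length l - 2"] assms le_add_diff_inverse2[OF assms]
      by (simp add: nth_append del: add_2_eq_Suc')
    ultimately show ?R by blast
  next
    assume R: ?R
    show ?L
    proof (intro allI impI)
      fix i assume "i + 2 < length (l @ [a])"
      then consider "i + 2 < length l" | "length l = i + 2" by force
      then show "(l @ [a]) ! i < (l @ [a]) ! (i + 2)"
      proof cases
        case 2
        then have "length l - 2 = i" by simp
        with R 2 show ?thesis by (simp add: nth_append)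
      qed (use R in \<open>simp add: nth_append\<close>)
    qed
  qed
  moreover have "(l @ [a]) ! 0 = l ! 0" "(l @ [a]) ! 1 = l ! 1"
    using assms by (auto simp: nth_append)
  ultimately show ?thesis using assms by (auto simp: two_step_def)
qed

text \<open>Both say the same, once along the reversed list and once by indices from the left, where
  it can be compared with classes of positions.\<close>

lemma zigzag_iff_two_step: "zigzag l \<longleftrightarrow> two_step (rev l)"
proof (induction l rule: zigzag.induct)
  case (1 a b c l)
  have "two_step (rev (b # c # l) @ [a]) \<longleftrightarrow> two_step (rev (b # c # l)) \<and> c < a"
    by (subst two_step_snoc) (auto simp: nth_append)
  with 1 show ?case by auto
qed (auto simp: two_step_def)

lemma two_step_mono:
  assumes "two_step \<pi>" "i < j" "j < length \<pi>" "even i = even j"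
  shows "\<pi> ! i < \<pi> ! j"
  using assms(2-4)
proof (induction j rule: less_induct)
  case (less j)
  have "i + 1 \<noteq> j" using less.prems by auto
  define k where "k = j - 2"
  have k: "j = k + 2" "i \<le> k" using less.prems \<open>i + 1 \<noteq> j\<close> by (auto simp: k_def)
  have "\<pi> ! k < \<pi> ! j" using assms(1) less.prems k by (auto simp: two_step_def)
  moreover have "\<pi> ! i \<le> \<pi> ! k"
    using less.IH[of k] less.prems k by (cases "i = k") auto
  ultimately show ?case by simp
qed

text \<open>Steps of two lead down from \<open>j\<close> to index 0 or 1, and the entry at 1 exceeds
  the one at 0.\<close>

lemma two_step_first:
  assumes "two_step \<pi>" "j < length \<pi>"
  shows "\<pi> ! 0 \<le> \<pi> ! j"
proof (cases "even j")
  case True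
  then show ?thesis using two_step_mono[OF assms(1), of 0 j] assms(2) by (cases "j = 0") auto
next
  case False
  then have "\<pi> ! 0 < \<pi> ! 1" using assms by (auto simp: two_step_def elim!: oddE)
  moreover have "\<pi> ! 1 \<le> \<pi> ! j"
    using two_step_mono[OF assms(1), of 1 j] False assms(2) by (cases "j = 1") (auto elim!: oddE)
  ultimately show ?thesis by simp
qed

lemma alternating_iff:
  assumes "length \<pi> = n" "n \<ge> 1"
  shows "alternating \<pi> \<longleftrightarrow> (if odd n then two_step \<pi> else two_step (butlast \<pi>) \<and> \<pi> ! (n - 2) < \<pi> ! (n - 1))"
proof (cases "odd n")
  case False
  with assms obtain a b l where l: "rev \<pi> = a # b # l"
    by (cases "rev \<pi>" rule: zigzag.cases) (auto simp flip: length_rev[of \<pi>])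
  then have pi: "\<pi> = rev l @ [b, a]" by (metis append.assoc append_Cons append_Nil rev.simps(2) rev_rev_ident)
  have "n = length l + 2" using assms pi by auto
  with False show ?thesis
    using zigzag_iff_two_step[of "b # l"] by (simp add: alternating_def pi nth_append butlast_append)
qed (use assms in \<open>simp add: alternating_def zigzag_iff_two_step\<close>)

text \<open>Index \<open>i\<close> stands for position \<open>i + 1\<close>, so for odd
  \<open>n\<close> the two classes are the parity classes of indices, and for even \<open>n\<close>
  this holds up to the last entry. The alternating shape makes the first entry the least, hence 1;
  conversely 1 in front gives the initial ascent.\<close>

lemma alternating_iff_class_increasing:
  assumes "\<pi> \<in> perms n" "n \<ge> 1"
  shows "alternating \<pi> \<longleftrightarrow> \<pi> ! 0 = 1 \<and> class_increasing n \<pi>"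
proof -
  have set: "set \<pi> = {1..n}" and dis: "distinct \<pi>" and len: "length \<pi> = n"
    using assms by (auto simp: permutations_of_set_def length_perms)
  have "1 \<in> set \<pi>" using set assms by auto
  then obtain k where k: "k < n" "\<pi> ! k = 1" using len by (metis in_set_conv_nth)
  have pos: "1 \<le> \<pi> ! i" if "i < n" for i using that set len nth_mem by fastforce
  have first: "\<pi> ! 0 < \<pi> ! 1" if "\<pi> ! 0 = 1" "1 < n"
  proof -
    have "\<pi> ! 0 \<noteq> \<pi> ! 1" using dis len that(2) by (simp add: nth_eq_iff_index_eq)
    with pos[of 1] that show ?thesis by simp
  qed
  show ?thesis
  proof (cases "odd n")
    case True
    have E: "i + 1 \<in> even_positions n \<longleftrightarrow> odd i" if "i < n" for i
      using that True by (cases "i + 1 = n") (auto simp: even_positions_iff)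
    show ?thesis
    proof
      assume "alternating \<pi>"
      then have t: "two_step \<pi>" using alternating_iff[OF len assms(2)] True by simp
      have "\<pi> ! 0 = 1" using two_step_first[OF t, of k] k len pos[of 0] by simp
      moreover have "class_increasing n \<pi>"
        unfolding class_increasing_def
      proof (intro allI impI)
        fix i j assume "i < j" "j < n" "(i + 1 \<in> even_positions n) = (j + 1 \<in> even_positions n)"
        then show "\<pi> ! i < \<pi> ! j" using two_step_mono[OF t] E[of i] E[of j] len by auto
      qed
      ultimately show "\<pi> ! 0 = 1 \<and> class_increasing n \<pi>" by blast
    next
      assume R: "\<pi> ! 0 = 1 \<and> class_increasing n \<pi>"
      have "\<pi> ! i < \<pi> ! (i + 2)" if "i + 2 < n" for i
      proof -
        have "(i + 1 \<in> even_positions n) = (i + 2 + 1 \<in> even_positions n)"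
          using E[of i] E[of "i + 2"] that by simp
        with R that show ?thesis unfolding class_increasing_def by (metis less_add_same_cancel1 zero_less_numeral)
      qed
      then show "alternating \<pi>"
        using alternating_iff[OF len assms(2)] True R first len by (simp add: two_step_def)
    qed
  next
    case False
    then have n2: "n \<ge> 2" using assms(2) by (cases "n = 1") auto
    define \<sigma> where "\<sigma> = butlast \<pi>"
    have lenS: "length \<sigma> = n - 1" and nth: "\<And>i. i < n - 1 \<Longrightarrow> \<sigma> ! i = \<pi> ! i"
      using len by (auto simp: \<sigma>_def nth_butlast)
    have E: "i + 1 \<in> even_positions n \<longleftrightarrow> odd i" if "i < n - 1" for i
      using that by (auto simp: even_positions_iff)
    \<comment> \<open>Here index \<open>n - 1\<close> is odd, yet position \<open>n\<close> belongs
      to the class of the even indices; this is why \<open>E\<close> stops before it.\<close>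
    have En: "n - 1 + 1 \<notin> even_positions n" using n2 by (simp add: even_positions_iff)
    show ?thesis
    proof
      assume "alternating \<pi>"
      then have t: "two_step \<sigma>" and last: "\<pi> ! (n - 2) < \<pi> ! (n - 1)"
        using alternating_iff[OF len assms(2)] False by (auto simp: \<sigma>_def)
      have "\<pi> ! 0 \<le> \<pi> ! j" if "j < n - 1" for j
        using two_step_first[OF t, of j] that lenS nth n2 by simp
      moreover from this[of "n - 2"] last n2 have "\<pi> ! 0 \<le> \<pi> ! (n - 1)"
        by (simp add: diff_less_mono2)
      ultimately have "\<pi> ! 0 \<le> \<pi> ! k" using k(1) by (cases "k = n - 1") auto
      then have "\<pi> ! 0 = 1" using k pos[of 0] by simp
      moreover have "class_increasing n \<pi>"
        unfolding class_increasing_def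
      proof (intro allI impI)
        fix i j
        assume ij: "i < j" "j < n" "(i + 1 \<in> even_positions n) = (j + 1 \<in> even_positions n)"
        show "\<pi> ! i < \<pi> ! j"
        proof (cases "j = n - 1")
          case True
          with ij En E[of i] have "even i" "i \<le> n - 2" by auto
          \<comment> \<open>Even indices lead up to \<open>n - 2\<close> in steps of two, and the
            final ascent adds the last entry to this chain.\<close>
          have "\<pi> ! i \<le> \<pi> ! (n - 2)"
          proof (cases "i = n - 2")
            case False
            with \<open>i \<le> n - 2\<close> have "i < n - 2" by simp
            moreover have "even (n - 2)" using \<open>\<not> odd n\<close> by simp
            ultimately show ?thesis
              using two_step_mono[OF t, of i "n - 2"] lenS nth[of i] nth[of "n - 2"] \<open>even i\<close> n2
              by (simp add: diff_less_mono2)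
          qed simp
          with last True show ?thesis by simp
        next
          case False
          with ij have j: "j < n - 1" by simp
          then have "even i = even j" using ij E[of i] E[of j] by auto
          then show ?thesis using two_step_mono[OF t, of i j] ij j lenS nth[of i] nth[of j] by simp
        qed
      qed
      ultimately show "\<pi> ! 0 = 1 \<and> class_increasing n \<pi>" by blast
    next
      assume R: "\<pi> ! 0 = 1 \<and> class_increasing n \<pi>"
      have "\<sigma> ! i < \<sigma> ! (i + 2)" if "i + 2 < n - 1" for i
      proof -
        have "(i + 1 \<in> even_positions n) = (i + 2 + 1 \<in> even_positions n)"
          using E[of i] E[of "i + 2"] that by simp
        moreover have "i < i + 2" "i + 2 < n" using that by auto
        ultimately have "\<pi> ! i < \<pi> ! (i + 2)" using R unfolding class_increasing_def by blast
        with nth[of i] nth[of "i + 2"] that show ?thesis by simp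
      qed
      moreover have "\<sigma> ! 0 < \<sigma> ! 1" if "1 < length \<sigma>"
        using that R first lenS nth[of 0] nth[of 1] by simp
      ultimately have "two_step \<sigma>" using lenS by (simp add: two_step_def)
      \<comment> \<open>Positions \<open>n - 1\<close> and \<open>n\<close> are neighbours in the
        same class, so class monotonicity is the final ascent.\<close>
      moreover have "\<pi> ! (n - 2) < \<pi> ! (n - 1)"
      proof -
        have "n - 2 + 1 \<notin> even_positions n" using E[of "n - 2"] False n2 by simp
        moreover have "n - 2 < n - 1" "n - 1 < n" using n2 by auto
        ultimately show ?thesis using R En unfolding class_increasing_def by blast
      qed
      ultimately show "alternating \<pi>"
        using alternating_iff[OF len assms(2)] False by (simp add: \<sigma>_def)
    qed
  qed
qed

section \<open>The set of right canonical permutations and the number of pinnacle sets\<close>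

lemma Pin_subset: "Pin \<pi> \<subseteq> set \<pi>"
  by (auto simp: Pin_alt peak_at_def)

lemma right_canonical_perms_eq:
  assumes "n \<ge> 1"
  shows "right_canonical_perms n = {\<pi> \<in> perms n. alternating \<pi>}"
proof
  show "right_canonical_perms n \<subseteq> {\<pi> \<in> perms n. alternating \<pi>}"
    using right_canonical_perms_subset[of n] right_canonical_alternating[OF assms]
    by (auto simp: right_canonical_perms_def)
  show "{\<pi> \<in> perms n. alternating \<pi>} \<subseteq> right_canonical_perms n"
  proof
    fix \<pi> assume "\<pi> \<in> {\<pi> \<in> perms n. alternating \<pi>}"
    then have "\<pi> \<in> perms n" "right_canonical n (Pin \<pi>) = \<pi>"
      using right_canonical_Pin[OF assms] by auto
    moreover from this have "Pin \<pi> \<subseteq> {1..n}" "admissible (Pin \<pi>)"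
      using Pin_subset[of \<pi>] by (auto simp: admissible_def permutations_of_set_def)
    ultimately show "\<pi> \<in> right_canonical_perms n"
      unfolding right_canonical_perms_def by (metis (mono_tags, lifting) mem_Collect_eq)
  qed
qed

lemma pinnacle_sets_eq:
  assumes "n \<ge> 1"
  shows "pinnacle_sets n = Pin ` right_canonical_perms n"
proof
  show "Pin ` right_canonical_perms n \<subseteq> pinnacle_sets n"
    using right_canonical_perms_subset[of n] by (auto simp: pinnacle_sets_def)
  show "pinnacle_sets n \<subseteq> Pin ` right_canonical_perms n"
  proof
    fix S assume "S \<in> pinnacle_sets n"
    then have S: "S \<subseteq> {1..n}" "admissible S"
      using Pin_subset by (fastforce simp: pinnacle_sets_def admissible_def permutations_of_set_def)+
    then have "Pin (right_canonical n S) = S" using right_canonical_alternating[OF assms] by blast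
    with S show "S \<in> Pin ` right_canonical_perms n" by (force simp: right_canonical_perms_def)
  qed
qed

theorem theorem2p2:
  fixes n :: nat
  assumes "n \<ge> 1"
  shows "right_canonical_perms n = interleaved_perms n \<and>
         card (pinnacle_sets n) = (n - 1) choose ((n - 1) div 2)"
proof
  show eq: "right_canonical_perms n = interleaved_perms n"
    using right_canonical_perms_eq[OF assms] interleaved_perms_iff[OF assms]
      alternating_iff_class_increasing[OF _ assms] by blast
  \<comment> \<open>\<open>right_canonical n\<close> is a left inverse of \<open>Pin\<close> on this
    set.\<close>
  have "inj_on Pin (right_canonical_perms n)"
    using right_canonical_Pin[OF assms] by (auto simp: right_canonical_perms_eq[OF assms] intro: inj_on_inverseI)
  then show "card (pinnacle_sets n) = (n - 1) choose ((n - 1) div 2)"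
    using card_interleaved_perms[OF assms] eq by (simp add: pinnacle_sets_eq[OF assms] card_image)
qed

end
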